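(* Let $\mathcal X$ be a finite set, let $Q$ be a probability mass function on $\mathcal X$ and let $P=P^*/Z$ be a probability mass function on $\mathcal X$, where $P^*$ is unnormalized and $Z=\sum_{x\in\mathcal X}P^*(x)$. Suppose $Q$ and $P$ have full support on $\mathcal X$, i.e. $Q(x)>0$ and $P^*(x)>0$ for all $x\in\mathcal X$. Let $N$ be a random nonnegative integer with $\Pr(N\ge i)>0$ for all $i\ge 0$, independent of all other randomness. Then the output $S$ of the Forward Coupled Estimator algorithm (defined in the context) has finite expectation, i.e. $\mathbb E[|S|]<\infty$, and is unbiased for $1/Z$, i.e. $\mathbb E[S]=1/Z$.
   Context: The importance weight is $w(x)=P^*(x)/Q(x)$. Forward Coupled Estimator algorithm (input $P^*$, $Q$, law of $N$): 1. Draw the random stopping time $N$. 2. Draw $X_{\mathrm{prop}}^{(0)},\dots,X_{\mathrm{prop}}^{(N)}$ i.i.d. from $Q$ and set $w^{(i)}=w(X_{\mathrm{prop}}^{(i)})$. 3. Initialize $S=1/w^{(0)}$, $w=w^{(0)}$, $\tilde w=w^{(0)}$. 4. For $i=1,\dots,N$: draw $r^{(i-1)}\sim\mathrm{Uniform}[0,1]$ (independent of everything else); compute $a=\min\{1,w^{(i)}/w\}$ and $\tilde a=\min\{1,w^{(i)}/\tilde w\}$; if $r^{(i-1)}<a$ set $w=w^{(i)}$; if $r^{(i-1)}<\tilde a$ and $i>1$ set $\tilde w=w^{(i)}$; then update $S\leftarrow S+\dfrac{w^{-1}-\tilde w^{-1}}{\Pr(N\ge i)}$. 5. Output $S$. 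*)

theory Defs
  imports "HOL-Probability.Probability"
begin

definition weight :: "('a \<Rightarrow> real) \<Rightarrow> 'a pmf \<Rightarrow> 'a \<Rightarrow> real" where
  "weight Pstar Q x = Pstar x / pmf Q x"

text \<open>
  State \<open>(S, v, v')\<close> after the first \<open>i\<close> passes of the loop, where \<open>v\<close> and \<open>v'\<close> are the weights
  held by the leading and by the lagging chain. The argument \<open>tail i\<close> is the probability
  of \<open>i \<le> N\<close>, the proposed weights are \<open>ws 0, ws 1, \<dots>\<close>, and the pass number \<open>Suc i\<close> uses the
  uniform draw \<open>r i\<close>.
\<close>

fun fce_state ::
  "(nat \<Rightarrow> real) \<Rightarrow> (nat \<Rightarrow> real) \<Rightarrow> (nat \<Rightarrow> real) \<Rightarrow> nat \<Rightarrow> real \<times> real \<times> real" where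
  "fce_state tail ws r 0 = (1 / ws 0, ws 0, ws 0)"
| "fce_state tail ws r (Suc i) =
    (let (S, v, v') = fce_state tail ws r i;
         a = min 1 (ws (Suc i) / v);
         a' = min 1 (ws (Suc i) / v');
         v1 = (if r i < a then ws (Suc i) else v);
         v1' = (if r i < a' \<and> Suc i > 1 then ws (Suc i) else v')
     in (S + (inverse v1 - inverse v1') / tail (Suc i), v1, v1'))"

definition fce_output ::
  "(nat \<Rightarrow> real) \<Rightarrow> (nat \<Rightarrow> real) \<Rightarrow> (nat \<Rightarrow> real) \<Rightarrow> nat \<Rightarrow> real" where
  "fce_output tail ws r n = fst (fce_state tail ws r n)"

text \<open>
  Joint independence of the stopping time, all proposals and all uniform draws. The library's
  \<open>indep_vars\<close> needs a single value type, so its definition is spelled out here for a family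
  with three value types.
\<close>

datatype draw = Stop | Proposal nat | Uniform nat

fun draw_events ::
  "'w measure \<Rightarrow> ('w \<Rightarrow> nat) \<Rightarrow> (nat \<Rightarrow> 'w \<Rightarrow> 'a) \<Rightarrow> (nat \<Rightarrow> 'w \<Rightarrow> real) \<Rightarrow> draw \<Rightarrow> 'w set set" where
  "draw_events M N X r Stop = {N -` A \<inter> space M | A. A \<in> sets (count_space UNIV)}"
| "draw_events M N X r (Proposal i) = {X i -` A \<inter> space M | A. A \<in> sets (count_space UNIV)}"
| "draw_events M N X r (Uniform i) = {r i -` A \<inter> space M | A. A \<in> sets borel}"

definition indep_draws ::
  "'w measure \<Rightarrow> ('w \<Rightarrow> nat) \<Rightarrow> (nat \<Rightarrow> 'w \<Rightarrow> 'a) \<Rightarrow> (nat \<Rightarrow> 'w \<Rightarrow> real) \<Rightarrow> bool" where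
  "indep_draws M N X r \<longleftrightarrow> prob_space.indep_sets M (draw_events M N X r) UNIV"

end

theory Submission
  imports Defs
begin

text \<open>
  The stopping weights \<open>1 / tail i\<close> cancel against the independent event \<open>i \<le> N\<close>, so the
  expectation of \<open>S\<close> is that of \<open>1 / w(X 0)\<close> plus the sum over \<open>i \<ge> 1\<close> of the expected
  differences of inverse weights. The lagging chain after \<open>i + 1\<close> passes has the law of the leading
  chain after \<open>i\<close> passes, so this sum telescopes to the limit of the expected inverse weight of a
  Metropolis--Hastings chain with target \<open>P\<close>, which is the mean of \<open>Q / P*\<close> under \<open>P\<close>, that is
  \<open>1 / Z\<close>. Both the exchange of sum and expectation and the convergence of the chain come from a
  state \<open>z\<close> of maximal weight: proposing \<open>z\<close> is accepted from everywhere, so it makes the two chains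
  meet, and it contracts the oscillation of functions under the transition operator by \<open>1 - Q z\<close>.
\<close>

section \<open>The two coupled chains as functions of the draws\<close>

definition accept :: "real \<Rightarrow> real \<Rightarrow> real" where
  "accept y v = max 0 (min 1 (y / v))"

definition mh_step :: "real \<Rightarrow> real \<Rightarrow> real \<Rightarrow> real" where
  "mh_step u y v = (if u < min 1 (y / v) then y else v)"

fun lead :: "(nat \<Rightarrow> real) \<Rightarrow> (nat \<Rightarrow> real) \<Rightarrow> nat \<Rightarrow> real" where
  "lead ws r 0 = ws 0"
| "lead ws r (Suc i) = mh_step (r i) (ws (Suc i)) (lead ws r i)"

text \<open>The first pass leaves the initial weight in place; from the second pass on this is the
  same chain started one pass late, driven by the same proposals and uniforms.\<close>

fun lag :: "(nat \<Rightarrow> real) \<Rightarrow> (nat \<Rightarrow> real) \<Rightarrow> nat \<Rightarrow> real" where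
  "lag ws r 0 = ws 0"
| "lag ws r (Suc i) = (if i = 0 then ws 0 else mh_step (r i) (ws (Suc i)) (lag ws r i))"

text \<open>The accumulator never feeds back into the chains, so the loop unrolls into a sum over
  them.\<close>

lemma fce_state_eq:
  "fce_state tail ws r n =
    (inverse (ws 0) + (\<Sum>i<n. (inverse (lead ws r (Suc i)) - inverse (lag ws r (Suc i))) / tail (Suc i)),
     lead ws r n, lag ws r n)"
  by (induction n) (auto simp: Let_def mh_step_def inverse_eq_divide)

lemma lead_in:
  assumes "\<And>i. ws i \<in> W" shows "lead ws r n \<in> W"
  using assms by (induction n) (auto simp: mh_step_def)

lemma lag_in:
  assumes "\<And>i. ws i \<in> W" shows "lag ws r n \<in> W"
  using assms by (induction n) (auto simp: mh_step_def)

text \<open>A proposal of maximal weight \<open>b\<close> has ratio at least 1, so a uniform below 1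
  accepts it in both chains. Once equal they stay equal, sharing proposal and uniform.
  \<open>1 \<le> j\<close> restricts to passes in which the lagging chain moves.\<close>

lemma chains_coupled:
  assumes "\<And>i. 0 < ws i" "\<And>i. ws i \<le> b" "\<And>i. r i < 1"
    and "1 \<le> j" "j \<le> n" "ws (Suc j) = b"
  shows "lead ws r (Suc n) = lag ws r (Suc n)"
  using \<open>j \<le> n\<close>
proof (induction n rule: dec_induct)
  case base
  have "lead ws r j \<in> {0<..b}" "lag ws r j \<in> {0<..b}"
    using assms(1,2) lead_in[of ws "{0<..b}" r j] lag_in[of ws "{0<..b}" r j] by auto
  then have "1 \<le> b / lead ws r j" "1 \<le> b / lag ws r j"
    by (auto simp: field_simps)
  then show ?case
    using assms by (auto simp: mh_step_def min_def)
next
  case (step n)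
  then show ?case using assms(4) by simp
qed

section \<open>The transition operator: stationarity, contraction, convergence\<close>

text \<open>
  The transition operator of the chain of weights, whose acceptance probability is clamped to
  \<open>[0, 1]\<close> so that it is an average at all real arguments and not only at positive ones.
\<close>

definition mh_op :: "'a pmf \<Rightarrow> ('a \<Rightarrow> real) \<Rightarrow> (real \<Rightarrow> real) \<Rightarrow> real \<Rightarrow> real" where
  "mh_op Q w g v =
    (\<Sum>x\<in>set_pmf Q. pmf Q x * (accept (w x) v * g (w x) + (1 - accept (w x) v) * g v))"

lemma accept_bounds: "0 \<le> accept y v" "accept y v \<le> 1"
  by (auto simp: accept_def)

lemma convex_combination_abs_le:
  fixes a :: real
  assumes "0 \<le> a" "a \<le> 1" "\<bar>s\<bar> \<le> c" "\<bar>t\<bar> \<le> c"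
  shows "\<bar>a * s + (1 - a) * t\<bar> \<le> c"
proof -
  have "\<bar>a * s + (1 - a) * t\<bar> \<le> a * \<bar>s\<bar> + (1 - a) * \<bar>t\<bar>"
    using assms abs_triangle_ineq[of "a * s" "(1 - a) * t"] by (simp add: abs_mult)
  also have "\<dots> \<le> a * c + (1 - a) * c"
    using assms by (intro add_mono mult_left_mono) auto
  finally show ?thesis by (simp add: algebra_simps)
qed

text \<open>Compares two states that receive the same proposal with different acceptance
  probabilities. For \<open>a \<le> b\<close> the difference is a combination of
  \<open>t - t'\<close> and \<open>t - s\<close> with nonnegative coefficients of total
  \<open>1 - a\<close>.\<close>

lemma convex_combinations_dist_le:
  fixes a b :: real
  assumes "0 \<le> a" "a \<le> 1" "0 \<le> b" "b \<le> 1"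
    and "\<bar>s - t\<bar> \<le> c" "\<bar>s - t'\<bar> \<le> c" "\<bar>t - t'\<bar> \<le> c"
  shows "\<bar>(a * s + (1 - a) * t) - (b * s + (1 - b) * t')\<bar> \<le> c"
  using assms
proof (induction a b arbitrary: t t' rule: linorder_wlog)
  case (le a b)
  have "(a * s + (1 - a) * t) - (b * s + (1 - b) * t') = (1 - b) * (t - t') + (b - a) * (t - s)"
    by (simp add: algebra_simps)
  also have "\<bar>\<dots>\<bar> \<le> (1 - b) * \<bar>t - t'\<bar> + (b - a) * \<bar>t - s\<bar>"
    using le abs_triangle_ineq[of "(1 - b) * (t - t')" "(b - a) * (t - s)"] by (simp add: abs_mult)
  also have "\<dots> \<le> (1 - b) * c + (b - a) * c"
    using le by (intro add_mono mult_left_mono) auto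
  also have "\<dots> = (1 - a) * c" by (simp add: algebra_simps)
  also have "\<dots> \<le> 1 * c" using le by (intro mult_right_mono) auto
  finally show ?case by simp
next
  case (sym a b)
  have "\<bar>(b * s + (1 - b) * t') - (a * s + (1 - a) * t)\<bar> \<le> c"
    using sym.prems by (intro sym.IH) (auto simp: abs_minus_commute)
  then show ?case by (simp only: abs_minus_commute)
qed

lemma sum_pmf_set_pmf: "finite (set_pmf Q) \<Longrightarrow> (\<Sum>x\<in>set_pmf Q. pmf Q x) = 1"
  by (intro sum_pmf_eq_1) auto

lemma mh_op_abs_le:
  assumes "finite (set_pmf Q)" "\<And>v. \<bar>g v\<bar> \<le> c"
  shows "\<bar>mh_op Q w g v\<bar> \<le> c"
proof -
  have "\<bar>mh_op Q w g v\<bar> \<le> (\<Sum>x\<in>set_pmf Q. pmf Q x * c)"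
    unfolding mh_op_def
    by (intro order_trans[OF sum_abs] sum_mono)
      (auto simp: abs_mult assms intro!: mult_left_mono convex_combination_abs_le accept_bounds)
  also have "\<dots> = c"
    using sum_pmf_set_pmf[OF assms(1)] by (simp flip: sum_distrib_right)
  finally show ?thesis .
qed

lemma measurable_mh_op [measurable]:
  assumes [measurable]: "g \<in> borel_measurable borel"
  shows "mh_op Q w g \<in> borel_measurable borel"
  unfolding mh_op_def[abs_def] accept_def by measurable

text \<open>Detailed balance: \<open>w x * accept (w y) (w x)\<close> equals
  \<open>min (w x) (w y)\<close>, which is symmetric in the two states.\<close>

lemma mh_op_stationary:
  assumes "\<And>x. x \<in> set_pmf Q \<Longrightarrow> 0 < w x" and fin: "finite (set_pmf Q)"
  shows "(\<Sum>x\<in>set_pmf Q. pmf Q x * w x * mh_op Q w g (w x)) = (\<Sum>x\<in>set_pmf Q. pmf Q x * w x * g (w x))"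
proof -
  let ?A = "set_pmf Q"
  define h where "h x y = pmf Q x * pmf Q y * min (w x) (w y) * (g (w y) - g (w x))" for x y
  have acc: "w x * accept (w y) (w x) = min (w x) (w y)" if "x \<in> ?A" "y \<in> ?A" for x y
    using assms(1)[OF that(1)] assms(1)[OF that(2)] by (auto simp: accept_def min_def field_simps)
  have "(\<Sum>x\<in>?A. pmf Q x * w x * mh_op Q w g (w x)) =
      (\<Sum>x\<in>?A. \<Sum>y\<in>?A. pmf Q x * pmf Q y * w x * g (w x) + h x y)"
    unfolding mh_op_def h_def sum_distrib_left
    by (intro sum.cong refl) (simp add: acc[symmetric] algebra_simps)
  also have "\<dots> = (\<Sum>x\<in>?A. \<Sum>y\<in>?A. pmf Q y * (pmf Q x * w x * g (w x))) + (\<Sum>x\<in>?A. \<Sum>y\<in>?A. h x y)"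
    by (simp add: sum.distrib mult_ac)
  \<comment> \<open>\<open>h\<close> is antisymmetric, so exchanging the summations shows that its
    double sum is its own negative.\<close>
  also have "(\<Sum>x\<in>?A. \<Sum>y\<in>?A. h x y) = (\<Sum>x\<in>?A. \<Sum>y\<in>?A. - h x y)"
    by (subst sum.swap) (auto simp: h_def min.commute algebra_simps intro!: sum.cong)
  then have "(\<Sum>x\<in>?A. \<Sum>y\<in>?A. h x y) = 0"
    by (simp add: sum_negf)
  finally show ?thesis
    using sum_pmf_set_pmf[OF fin] by (simp flip: sum_distrib_right)
qed

text \<open>The proposal \<open>z\<close> leads to \<open>w z\<close> from both states and its terms
  cancel. The other proposals have total mass \<open>1 - pmf Q z\<close>, and each contributes a
  difference of at most \<open>c\<close>.\<close>

lemma mh_op_contraction: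
  assumes pos: "\<And>x. x \<in> set_pmf Q \<Longrightarrow> 0 < w x" and fin: "finite (set_pmf Q)"
    and z: "z \<in> set_pmf Q" "\<And>x. x \<in> set_pmf Q \<Longrightarrow> w x \<le> w z"
    and osc: "\<And>x y. x \<in> set_pmf Q \<Longrightarrow> y \<in> set_pmf Q \<Longrightarrow> \<bar>g (w x) - g (w y)\<bar> \<le> c"
    and xy: "x \<in> set_pmf Q" "y \<in> set_pmf Q"
  shows "\<bar>mh_op Q w g (w x) - mh_op Q w g (w y)\<bar> \<le> (1 - pmf Q z) * c"
proof -
  define k where "k u v = accept (w u) v * g (w u) + (1 - accept (w u) v) * g v" for u v
  have "accept (w z) (w u) = 1" if "u \<in> set_pmf Q" for u
    using pos[OF that] z(2)[OF that] by (simp add: accept_def)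
  then have kz: "k z (w x) = k z (w y)"
    using xy by (simp add: k_def)
  have "mh_op Q w g (w x) - mh_op Q w g (w y) = (\<Sum>u\<in>set_pmf Q. pmf Q u * (k u (w x) - k u (w y)))"
    by (simp add: mh_op_def k_def right_diff_distrib sum_subtractf)
  also have "\<dots> = (\<Sum>u\<in>set_pmf Q - {z}. pmf Q u * (k u (w x) - k u (w y)))"
    using fin z(1) kz by (subst sum.remove[of _ z]) auto
  also have "\<bar>\<dots>\<bar> \<le> (\<Sum>u\<in>set_pmf Q - {z}. pmf Q u * c)"
    unfolding k_def
    by (intro order_trans[OF sum_abs] sum_mono)
      (auto simp: abs_mult intro!: mult_left_mono convex_combinations_dist_le accept_bounds osc xy)
  also have "\<dots> = (1 - pmf Q z) * c"
    using sum_pmf_set_pmf[OF fin] fin z(1) by (simp add: sum_diff1 flip: sum_distrib_right)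
  finally show ?thesis .
qed

lemma maximal_weight:
  fixes w :: "'a \<Rightarrow> real"
  assumes "finite (set_pmf Q)"
  shows "\<exists>z\<in>set_pmf Q. \<forall>x\<in>set_pmf Q. w x \<le> w z"
proof -
  have "Max (w ` set_pmf Q) \<in> w ` set_pmf Q"
    using assms set_pmf_not_empty by (intro Max_in) auto
  then obtain z where "z \<in> set_pmf Q" "Max (w ` set_pmf Q) = w z"
    by blast
  moreover have "w x \<le> Max (w ` set_pmf Q)" if "x \<in> set_pmf Q" for x
    using assms that by (intro Max_ge) auto
  ultimately show ?thesis
    by auto
qed

text \<open>By stationarity the average of the iterates under the normalised weights
  \<open>pmf Q x * w x\<close> is constant in \<open>n\<close>. It differs from the average under
  \<open>Q\<close> by at most the oscillation, which decays geometrically.\<close>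

lemma mh_op_iterate_tendsto:
  assumes pos: "\<And>x. x \<in> set_pmf Q \<Longrightarrow> 0 < w x" and fin: "finite (set_pmf Q)"
  shows "(\<lambda>n. \<Sum>x\<in>set_pmf Q. pmf Q x * (mh_op Q w ^^ n) g (w x))
    \<longlonglongrightarrow> (\<Sum>x\<in>set_pmf Q. pmf Q x * w x * g (w x)) / (\<Sum>x\<in>set_pmf Q. pmf Q x * w x)"
    (is "?m \<longlonglongrightarrow> ?L / ?Z")
proof -
  let ?A = "set_pmf Q"
  obtain z where z: "z \<in> ?A" "\<And>x. x \<in> ?A \<Longrightarrow> w x \<le> w z"
    using maximal_weight[OF fin, of w] by blast
  \<comment> \<open>A crude bound on the initial oscillation; any finite constant would do.\<close>
  define c where "c = (\<Sum>x\<in>?A. \<Sum>y\<in>?A. \<bar>g (w x) - g (w y)\<bar>)"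
  have osc0: "\<bar>g (w x) - g (w y)\<bar> \<le> c" if "x \<in> ?A" "y \<in> ?A" for x y
  proof -
    have "\<bar>g (w x) - g (w y)\<bar> \<le> (\<Sum>y\<in>?A. \<bar>g (w x) - g (w y)\<bar>)"
      using fin that by (intro member_le_sum) auto
    also have "\<dots> \<le> c"
      unfolding c_def using fin that by (intro member_le_sum sum_nonneg) auto
    finally show ?thesis .
  qed
  have osc: "\<bar>(mh_op Q w ^^ n) g (w x) - (mh_op Q w ^^ n) g (w y)\<bar> \<le> (1 - pmf Q z) ^ n * c"
    if "x \<in> ?A" "y \<in> ?A" for x y n
    using that
  proof (induction n arbitrary: x y)
    case (Suc n)
    have "\<bar>mh_op Q w ((mh_op Q w ^^ n) g) (w x) - mh_op Q w ((mh_op Q w ^^ n) g) (w y)\<bar>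
        \<le> (1 - pmf Q z) * ((1 - pmf Q z) ^ n * c)"
      by (rule mh_op_contraction[where w = w and z = z and g = "(mh_op Q w ^^ n) g", OF pos fin z Suc.IH Suc.prems])
    then show ?case by (simp add: mult.assoc)
  qed (simp add: osc0)
  have Z: "?Z > 0"
    using fin pos by (intro sum_pos) (auto simp: set_pmf_not_empty pmf_positive)
  have stat: "(\<Sum>x\<in>?A. pmf Q x * w x * (mh_op Q w ^^ n) g (w x)) = ?L" for n
    by (induction n) (simp_all add: mh_op_stationary[OF pos fin])
  have bound: "\<bar>?m n - ?L / ?Z\<bar> \<le> (1 - pmf Q z) ^ n * c" for n
  proof -
    let ?G = "\<lambda>x. (mh_op Q w ^^ n) g (w x)"
    \<comment> \<open>Clearing the denominator turns the difference of two averages into a double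
      sum of pairwise differences.\<close>
    have "(?m n - ?L / ?Z) * ?Z = ?m n * ?Z - (\<Sum>x\<in>?A. pmf Q x) * (\<Sum>y\<in>?A. pmf Q y * w y * ?G y)"
      using Z sum_pmf_set_pmf[OF fin] stat[of n] by (simp add: left_diff_distrib)
    also have "\<dots> = (\<Sum>x\<in>?A. \<Sum>y\<in>?A. pmf Q x * (pmf Q y * w y) * (?G x - ?G y))"
      unfolding sum_product sum_subtractf[symmetric]
      by (intro sum.cong refl) (simp add: right_diff_distrib mult_ac)
    finally have eq: "(?m n - ?L / ?Z) * ?Z = (\<Sum>x\<in>?A. \<Sum>y\<in>?A. pmf Q x * (pmf Q y * w y) * (?G x - ?G y))" .
    have "\<bar>?m n - ?L / ?Z\<bar> * ?Z = \<bar>\<Sum>x\<in>?A. \<Sum>y\<in>?A. pmf Q x * (pmf Q y * w y) * (?G x - ?G y)\<bar>"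
      by (simp only: eq[symmetric] abs_mult abs_of_pos[OF Z])
    also have "\<dots> \<le> (\<Sum>x\<in>?A. \<Sum>y\<in>?A. pmf Q x * (pmf Q y * w y) * ((1 - pmf Q z) ^ n * c))"
    proof (rule order_trans[OF sum_abs sum_mono], rule order_trans[OF sum_abs sum_mono])
      fix x y assume "x \<in> ?A" "y \<in> ?A"
      then show "\<bar>pmf Q x * (pmf Q y * w y) * (?G x - ?G y)\<bar> \<le> pmf Q x * (pmf Q y * w y) * ((1 - pmf Q z) ^ n * c)"
        using osc[of x y n] pos[of y] by (simp add: abs_mult mult_left_mono)
    qed
    also have "\<dots> = (\<Sum>x\<in>?A. pmf Q x) * ?Z * ((1 - pmf Q z) ^ n * c)"
      by (subst sum_product) (simp only: sum_distrib_right)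
    also have "\<dots> = ((1 - pmf Q z) ^ n * c) * ?Z"
      using sum_pmf_set_pmf[OF fin] by simp
    finally show ?thesis
      using Z by (simp only: mult_le_cancel_right_pos)
  qed
  have "\<bar>1 - pmf Q z\<bar> < 1"
    using pmf_positive[OF z(1)] pmf_le_1[of Q z] by auto
  then have "(\<lambda>n. (1 - pmf Q z) ^ n * c) \<longlonglongrightarrow> 0"
    by (intro tendsto_mult_left_zero LIMSEQ_power_zero) auto
  then have "(\<lambda>n. ?m n - ?L / ?Z) \<longlonglongrightarrow> 0"
    by (rule Lim_null_comparison[rotated]) (use bound in auto)
  then show ?thesis by (simp add: LIM_zero_iff)
qed

section \<open>Measurability and the law of a single step\<close>

lemma measurable_mh_step [measurable]:
  assumes [measurable]: "f \<in> borel_measurable M" "g \<in> borel_measurable M" "h \<in> borel_measurable M"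
  shows "(\<lambda>x. mh_step (f x) (g x) (h x)) \<in> borel_measurable M"
  unfolding mh_step_def by measurable

lemma lead_cong:
  assumes "\<And>i. i \<le> n \<Longrightarrow> ws i = ws' i" "\<And>i. i < n \<Longrightarrow> r i = r' i"
  shows "lead ws r n = lead ws' r' n"
  using assms by (induction n) auto

lemma lag_cong:
  assumes "\<And>i. i \<le> n \<Longrightarrow> ws i = ws' i" "\<And>i. i < n \<Longrightarrow> r i = r' i"
  shows "lag ws r n = lag ws' r' n"
  using assms by (induction n) auto

lemma measurable_lead:
  assumes "\<And>i. i \<le> n \<Longrightarrow> (\<lambda>x. ws x i) \<in> borel_measurable M" "\<And>i. i < n \<Longrightarrow> (\<lambda>x. r x i) \<in> borel_measurable M"
  shows "(\<lambda>x. lead (ws x) (r x) n) \<in> borel_measurable M"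
  using assms by (induction n) (auto intro!: measurable_mh_step)

lemma measurable_lag:
  assumes "\<And>i. i \<le> n \<Longrightarrow> (\<lambda>x. ws x i) \<in> borel_measurable M" "\<And>i. i < n \<Longrightarrow> (\<lambda>x. r x i) \<in> borel_measurable M"
  shows "(\<lambda>x. lag (ws x) (r x) n) \<in> borel_measurable M"
  using assms by (induction n) (auto intro!: measurable_mh_step)

lemma prob_space_unit_uniform: "prob_space (uniform_measure lborel {0..1::real})"
  by (rule prob_space_uniform_measure) auto

lemma measure_unit_uniform_lessThan:
  "measure (uniform_measure lborel {0..1}) {..<min 1 (y / v)} = accept y v"
proof -
  have "{0..1} \<inter> {..<min 1 (y / v)} = {0..<accept y v}"
    by (auto simp: accept_def max_def min_def)
  then show ?thesis
    using accept_bounds[of y v] by (simp add: measure_uniform_measure)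
qed

text \<open>For fixed \<open>y\<close> and \<open>v\<close> the integrand takes two values, so it is
  affine in the indicator of acceptance.\<close>

lemma integral_unit_uniform_mh_step:
  fixes g :: "real \<Rightarrow> real"
  shows "(\<integral>u. g (mh_step u y v) \<partial>uniform_measure lborel {0..1}) = accept y v * g y + (1 - accept y v) * g v"
proof -
  interpret U: prob_space "uniform_measure lborel {0..1::real}"
    by (rule prob_space_unit_uniform)
  let ?I = "indicator {..<min 1 (y / v)} :: real \<Rightarrow> real"
  have [simp]: "integrable (uniform_measure lborel {0..1}) ?I"
    by (rule U.integrable_const_bound[where B = 1]) auto
  have "(\<integral>u. g (mh_step u y v) \<partial>uniform_measure lborel {0..1}) =
      (\<integral>u. g v + (g y - g v) * ?I u \<partial>uniform_measure lborel {0..1})"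
    by (intro Bochner_Integration.integral_cong) (auto simp: mh_step_def indicator_def)
  also have "\<dots> = g v + (g y - g v) * accept y v"
    by (subst Bochner_Integration.integral_add)
      (simp_all add: measure_unit_uniform_lessThan U.prob_space)
  finally show ?thesis by (simp add: algebra_simps)
qed

text \<open>The Markov property, for any current state \<open>V\<close> independent of the new
  proposal and uniform, so that it serves both chains. Independence enters as product laws, ready
  for Fubini.\<close>

lemma (in prob_space) expectation_mh_step:
  assumes [measurable]: "V \<in> borel_measurable M" "W \<in> borel_measurable M" "U \<in> borel_measurable M"
    and VWU: "distr M borel V \<Otimes>\<^sub>M distr M (borel \<Otimes>\<^sub>M borel) (\<lambda>\<omega>. (W \<omega>, U \<omega>)) =
      distr M (borel \<Otimes>\<^sub>M (borel \<Otimes>\<^sub>M borel)) (\<lambda>\<omega>. (V \<omega>, W \<omega>, U \<omega>))"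
    and WU: "distr M borel W \<Otimes>\<^sub>M distr M borel U = distr M (borel \<Otimes>\<^sub>M borel) (\<lambda>\<omega>. (W \<omega>, U \<omega>))"
    and distW: "distr M borel W = distr (measure_pmf Q) borel w"
    and distU: "distr M borel U = uniform_measure lborel {0..1}"
    and fin: "finite (set_pmf Q)"
    and g[measurable]: "g \<in> borel_measurable borel" and bound: "\<And>v. \<bar>g v\<bar> \<le> c"
  shows "expectation (\<lambda>\<omega>. g (mh_step (U \<omega>) (W \<omega>) (V \<omega>))) = expectation (\<lambda>\<omega>. mh_op Q w g (V \<omega>))"
proof -
  let ?V = "distr M borel V" and ?W = "distr M borel W" and ?U = "distr M borel U"
  interpret V: prob_space ?V by (rule prob_space_distr) measurable
  interpret W: prob_space ?W by (rule prob_space_distr) measurable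
  interpret U: prob_space ?U by (rule prob_space_distr) measurable
  interpret WU: pair_prob_space ?W ?U ..
  interpret VWU: pair_prob_space ?V "?W \<Otimes>\<^sub>M ?U" ..
  let ?h = "\<lambda>(v, y, u). g (mh_step u y v)"
  have [measurable]: "?h \<in> borel_measurable (borel \<Otimes>\<^sub>M (borel \<Otimes>\<^sub>M borel))"
    by measurable
  have joint: "distr M (borel \<Otimes>\<^sub>M (borel \<Otimes>\<^sub>M borel)) (\<lambda>\<omega>. (V \<omega>, W \<omega>, U \<omega>)) = ?V \<Otimes>\<^sub>M (?W \<Otimes>\<^sub>M ?U)"
    using VWU WU by simp
  have sets: "sets (?V \<Otimes>\<^sub>M (?W \<Otimes>\<^sub>M ?U)) = sets (borel \<Otimes>\<^sub>M (borel \<Otimes>\<^sub>M borel))"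
    by (intro sets_pair_measure_cong) auto
  have int: "integrable (?V \<Otimes>\<^sub>M (?W \<Otimes>\<^sub>M ?U)) ?h"
    by (rule VWU.P.integrable_const_bound[where B = c]) (auto simp: bound measurable_cong_sets[OF sets refl])
  have int': "integrable (?W \<Otimes>\<^sub>M ?U) (\<lambda>(y, u). g (mh_step u y v))" for v
    by (rule WU.P.integrable_const_bound[where B = c]) (auto simp: bound)
  have step: "(\<integral>yu. ?h (v, yu) \<partial>(?W \<Otimes>\<^sub>M ?U)) = mh_op Q w g v" for v
  proof -
    \<comment> \<open>The uniform is integrated first, at a fixed proposal, which produces the
      acceptance probability.\<close>
    have "(\<integral>yu. ?h (v, yu) \<partial>(?W \<Otimes>\<^sub>M ?U)) = (\<integral>y. (\<integral>u. g (mh_step u y v) \<partial>?U) \<partial>?W)"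
      using WU.integral_fst'[OF int'[of v]] by (simp add: case_prod_unfold)
    also have "\<dots> = (\<integral>y. accept y v * g y + (1 - accept y v) * g v \<partial>distr (measure_pmf Q) borel w)"
      unfolding distU distW by (simp add: integral_unit_uniform_mh_step)
    also have "\<dots> = (\<integral>x. accept (w x) v * g (w x) + (1 - accept (w x) v) * g v \<partial>measure_pmf Q)"
      by (rule integral_distr) (auto simp: accept_def)
    also have "\<dots> = mh_op Q w g v"
      unfolding mh_op_def using fin by (subst integral_measure_pmf_real[where A = "set_pmf Q"]) (auto simp: mult.commute)
    finally show ?thesis .
  qed
  have "expectation (\<lambda>\<omega>. g (mh_step (U \<omega>) (W \<omega>) (V \<omega>))) =
      integral\<^sup>L (distr M (borel \<Otimes>\<^sub>M (borel \<Otimes>\<^sub>M borel)) (\<lambda>\<omega>. (V \<omega>, W \<omega>, U \<omega>))) ?h"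
    by (subst integral_distr) auto
  also have "\<dots> = (\<integral>v. mh_op Q w g v \<partial>?V)"
    unfolding joint VWU.integral_fst'[OF int, symmetric] step ..
  also have "\<dots> = expectation (\<lambda>\<omega>. mh_op Q w g (V \<omega>))"
    by (subst integral_distr) auto
  finally show ?thesis .
qed

section \<open>Joint independence of the draws\<close>

text \<open>\<open>weight_0\<close> records the value of a division by zero outside the support;
  with it the identities between inverse weights hold at every sample point and not just almost
  surely.\<close>

locale coupled_chains = prob_space M for M :: "'w measure" +
  fixes Q :: "'a pmf" and w :: "'a \<Rightarrow> real"
    and N :: "'w \<Rightarrow> nat" and X :: "nat \<Rightarrow> 'w \<Rightarrow> 'a" and r :: "nat \<Rightarrow> 'w \<Rightarrow> real"
  assumes finite_support: "finite (set_pmf Q)"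
    and weight_pos: "\<And>x. x \<in> set_pmf Q \<Longrightarrow> 0 < w x"
    and weight_0: "\<And>x. x \<notin> set_pmf Q \<Longrightarrow> w x = 0"
    and measurable_N [measurable]: "N \<in> measurable M (count_space UNIV)"
    and measurable_X [measurable]: "\<And>i. X i \<in> measurable M (count_space UNIV)"
    and measurable_r [measurable]: "\<And>i. r i \<in> borel_measurable M"
    and indep: "indep_draws M N X r"
    and distr_X: "\<And>i. distr M (count_space UNIV) (X i) = measure_pmf Q"
    and distr_r: "\<And>i. distr M borel (r i) = uniform_measure lborel {0..1}"
begin

lemma measurable_weight [measurable]: "(\<lambda>\<omega>. w (X i \<omega>)) \<in> borel_measurable M"
  by (rule measurable_compose[OF measurable_X]) simp

text \<open>Embedding \<open>N\<close> into the reals and passing from proposals to weights gives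
  all draws one value type, so that \<open>indep_vars\<close> applies.\<close>

fun draws :: "draw \<Rightarrow> 'w \<Rightarrow> real" where
  "draws Stop \<omega> = real (N \<omega>)"
| "draws (Proposal i) \<omega> = w (X i \<omega>)"
| "draws (Uniform i) \<omega> = r i \<omega>"

abbreviation leading :: "nat \<Rightarrow> 'w \<Rightarrow> real" where
  "leading n \<omega> \<equiv> lead (\<lambda>i. w (X i \<omega>)) (\<lambda>i. r i \<omega>) n"

abbreviation lagging :: "nat \<Rightarrow> 'w \<Rightarrow> real" where
  "lagging n \<omega> \<equiv> lag (\<lambda>i. w (X i \<omega>)) (\<lambda>i. r i \<omega>) n"

lemma indep_vars_draws: "indep_vars (\<lambda>_. borel) draws UNIV"
proof -
  have "random_variable borel (draws d)" for d
  proof -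
    have "draws Stop = (\<lambda>\<omega>. real (N \<omega>))" "draws (Proposal i) = (\<lambda>\<omega>. w (X i \<omega>))" "draws (Uniform i) = r i" for i
      by auto
    then show ?thesis by (cases d) simp_all
  qed
  moreover have "{draws d -` A \<inter> space M | A. A \<in> sets borel} \<subseteq> draw_events M N X r d" for d
  proof safe
    fix A :: "real set" assume A: "A \<in> sets borel"
    have "draws Stop -` A = N -` (real -` A)" "draws (Proposal i) -` A = X i -` (w -` A)"
      "draws (Uniform i) -` A = r i -` A" for i
      by auto
    then show "draws d -` A \<inter> space M \<in> draw_events M N X r d"
      using A by (cases d) (simp_all only: draw_events.simps, auto)
  qed
  ultimately show ?thesis
    using indep_sets_mono_sets[OF indep[unfolded indep_draws_def]] by (simp add: indep_vars_def2)
qed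

text \<open>Functions of disjoint blocks of draws are independent: the blocks have a product law,
  and \<open>F\<close> and \<open>G\<close> push it forward.\<close>

lemma joint_distr_draws:
  assumes disj: "A \<inter> B = {}"
    and F [measurable]: "F \<in> measurable (PiM A (\<lambda>_. borel)) S"
    and G [measurable]: "G \<in> measurable (PiM B (\<lambda>_. borel)) T"
    and f: "\<And>\<omega>. f \<omega> = F (restrict (\<lambda>d. draws d \<omega>) A)"
    and g: "\<And>\<omega>. g \<omega> = G (restrict (\<lambda>d. draws d \<omega>) B)"
  shows "distr M S f \<Otimes>\<^sub>M distr M T g = distr M (S \<Otimes>\<^sub>M T) (\<lambda>\<omega>. (f \<omega>, g \<omega>))"
proof -
  let ?R = "\<lambda>A \<omega>. restrict (\<lambda>d. draws d \<omega>) A" and ?P = "\<lambda>A. PiM A (\<lambda>_. borel) :: (draw \<Rightarrow> real) measure"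
  have R [measurable]: "?R A \<in> measurable M (?P A)" "?R B \<in> measurable M (?P B)"
    and joint: "distr M (?P A) (?R A) \<Otimes>\<^sub>M distr M (?P B) (?R B) = distr M (?P A \<Otimes>\<^sub>M ?P B) (\<lambda>\<omega>. (?R A \<omega>, ?R B \<omega>))"
    using indep_var_restrict[OF indep_vars_draws disj] by (auto simp: indep_var_distribution_eq)
  have "distr M S f = distr (distr M (?P A) (?R A)) S F" "distr M T g = distr (distr M (?P B) (?R B)) T G"
    by (simp_all add: distr_distr comp_def f g cong: distr_cong)
  moreover have "prob_space (distr M T g)"
  proof (rule prob_space_distr)
    show "g \<in> measurable M T" unfolding g[abs_def] by measurable
  qed
  ultimately have "distr M S f \<Otimes>\<^sub>M distr M T g =
      distr (distr M (?P A) (?R A) \<Otimes>\<^sub>M distr M (?P B) (?R B)) (S \<Otimes>\<^sub>M T) (\<lambda>(x, y). (F x, G y))"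
    by (metis F G measurable_distr_eq1 pair_measure_distr prob_space_imp_sigma_finite)
  also have "\<dots> = distr M (S \<Otimes>\<^sub>M T) (\<lambda>\<omega>. (f \<omega>, g \<omega>))"
    unfolding joint by (subst distr_distr) (auto simp: comp_def f g)
  finally show ?thesis .
qed

text \<open>The draws that fix both chains after \<open>n\<close> passes. Pass \<open>Suc i\<close>
  uses \<open>Proposal (Suc i)\<close> and \<open>Uniform i\<close>, hence the two different
  bounds.\<close>

definition past :: "nat \<Rightarrow> draw set" where
  "past n = Proposal ` {..n} \<union> Uniform ` {..<n}"

lemma leading_past:
  "leading n \<omega> = lead (\<lambda>i. restrict (\<lambda>d. draws d \<omega>) (past n) (Proposal i))
    (\<lambda>i. restrict (\<lambda>d. draws d \<omega>) (past n) (Uniform i)) n"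
  by (rule lead_cong) (auto simp: past_def)

lemma lagging_past:
  "lagging n \<omega> = lag (\<lambda>i. restrict (\<lambda>d. draws d \<omega>) (past n) (Proposal i))
    (\<lambda>i. restrict (\<lambda>d. draws d \<omega>) (past n) (Uniform i)) n"
  by (rule lag_cong) (auto simp: past_def)

lemma measurable_lead_past:
  "(\<lambda>y. lead (\<lambda>i. y (Proposal i)) (\<lambda>i. y (Uniform i)) n) \<in> borel_measurable (PiM (past n) (\<lambda>_. borel))"
  by (rule measurable_lead) (auto simp: past_def)

lemma measurable_lag_past:
  "(\<lambda>y. lag (\<lambda>i. y (Proposal i)) (\<lambda>i. y (Uniform i)) n) \<in> borel_measurable (PiM (past n) (\<lambda>_. borel))"
  by (rule measurable_lag) (auto simp: past_def)

lemma measurable_leading [measurable]: "leading n \<in> borel_measurable M"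
  by (rule measurable_lead) auto

lemma measurable_lagging [measurable]: "lagging n \<in> borel_measurable M"
  by (rule measurable_lag) auto

lemma measurable_current:
  "(\<lambda>y. (y (Proposal (Suc n)), y (Uniform n))) \<in>
    PiM {Proposal (Suc n), Uniform n} (\<lambda>_. borel) \<rightarrow>\<^sub>M borel \<Otimes>\<^sub>M borel"
  by (intro measurable_Pair measurable_component_singleton) auto

lemma joint_distr_leading:
  "distr M borel (leading n) \<Otimes>\<^sub>M distr M (borel \<Otimes>\<^sub>M borel) (\<lambda>\<omega>. (w (X (Suc n) \<omega>), r n \<omega>)) =
    distr M (borel \<Otimes>\<^sub>M (borel \<Otimes>\<^sub>M borel)) (\<lambda>\<omega>. (leading n \<omega>, w (X (Suc n) \<omega>), r n \<omega>))"
  by (rule joint_distr_draws[OF _ measurable_lead_past measurable_current leading_past]) (auto simp: past_def)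

lemma joint_distr_lagging:
  "distr M borel (lagging n) \<Otimes>\<^sub>M distr M (borel \<Otimes>\<^sub>M borel) (\<lambda>\<omega>. (w (X (Suc n) \<omega>), r n \<omega>)) =
    distr M (borel \<Otimes>\<^sub>M (borel \<Otimes>\<^sub>M borel)) (\<lambda>\<omega>. (lagging n \<omega>, w (X (Suc n) \<omega>), r n \<omega>))"
  by (rule joint_distr_draws[OF _ measurable_lag_past measurable_current lagging_past]) (auto simp: past_def)

lemma joint_distr_proposal_uniform:
  "distr M borel (\<lambda>\<omega>. w (X (Suc n) \<omega>)) \<Otimes>\<^sub>M distr M borel (r n) =
    distr M (borel \<Otimes>\<^sub>M borel) (\<lambda>\<omega>. (w (X (Suc n) \<omega>), r n \<omega>))"
  by (rule joint_distr_draws[where A = "{Proposal (Suc n)}" and B = "{Uniform n}"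
        and F = "\<lambda>y. y (Proposal (Suc n))" and G = "\<lambda>y. y (Uniform n)"]) auto

section \<open>Expectations along the two chains\<close>

lemma distr_weight: "distr M borel (\<lambda>\<omega>. w (X i \<omega>)) = distr (measure_pmf Q) borel w"
  unfolding distr_X[of i, symmetric] by (subst distr_distr) (auto simp: comp_def)

lemma expectation_proposal: "expectation (\<lambda>\<omega>. g (X i \<omega>)) = (\<Sum>x\<in>set_pmf Q. pmf Q x * g x)" for g :: "'a \<Rightarrow> real"
proof -
  have "expectation (\<lambda>\<omega>. g (X i \<omega>)) = (\<integral>x. g x \<partial>measure_pmf Q)"
    unfolding distr_X[of i, symmetric] by (subst integral_distr) auto
  then show ?thesis
    using finite_support by (subst (asm) integral_measure_pmf_real[where A = "set_pmf Q"]) (auto simp: mult.commute)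
qed

text \<open>The induction peels off the last pass and absorbs it into the test function, which stays
  measurable and bounded by \<open>c\<close>; hence \<open>g\<close> is arbitrary.\<close>

lemma expectation_leading:
  assumes "g \<in> borel_measurable borel" "\<And>v. \<bar>g v\<bar> \<le> c"
  shows "expectation (\<lambda>\<omega>. g (leading n \<omega>)) = (\<Sum>x\<in>set_pmf Q. pmf Q x * (mh_op Q w ^^ n) g (w x))"
  using assms
proof (induction n arbitrary: g)
  case 0
  then show ?case using expectation_proposal[of "\<lambda>x. g (w x)" 0] by simp
next
  case (Suc n)
  have "expectation (\<lambda>\<omega>. g (leading (Suc n) \<omega>)) = expectation (\<lambda>\<omega>. mh_op Q w g (leading n \<omega>))"
    using expectation_mh_step[OF measurable_leading measurable_weight measurable_r joint_distr_leading
        joint_distr_proposal_uniform distr_weight distr_r finite_support Suc.prems, of n]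
    by (simp only: lead.simps)
  also have "\<dots> = (\<Sum>x\<in>set_pmf Q. pmf Q x * (mh_op Q w ^^ n) (mh_op Q w g) (w x))"
    using Suc.prems by (intro Suc.IH measurable_mh_op mh_op_abs_le finite_support)
  finally show ?case by (simp only: funpow_Suc_right comp_apply)
qed

text \<open>The idle first pass moves the start of the induction by one, so the value agrees with
  that of the leading chain after \<open>n\<close> passes.\<close>

lemma expectation_lagging:
  assumes "g \<in> borel_measurable borel" "\<And>v. \<bar>g v\<bar> \<le> c"
  shows "expectation (\<lambda>\<omega>. g (lagging (Suc n) \<omega>)) = (\<Sum>x\<in>set_pmf Q. pmf Q x * (mh_op Q w ^^ n) g (w x))"
  using assms
proof (induction n arbitrary: g)
  case 0
  then show ?case using expectation_proposal[of "\<lambda>x. g (w x)" 0] by simp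
next
  case (Suc n)
  have "expectation (\<lambda>\<omega>. g (lagging (Suc (Suc n)) \<omega>)) = expectation (\<lambda>\<omega>. mh_op Q w g (lagging (Suc n) \<omega>))"
    using expectation_mh_step[OF measurable_lagging measurable_weight measurable_r joint_distr_lagging
        joint_distr_proposal_uniform distr_weight distr_r finite_support Suc.prems, of "Suc n"]
    by (simp only: lag.simps nat.simps if_False)
  also have "\<dots> = (\<Sum>x\<in>set_pmf Q. pmf Q x * (mh_op Q w ^^ n) (mh_op Q w g) (w x))"
    using Suc.prems by (intro Suc.IH measurable_mh_op mh_op_abs_le finite_support)
  finally show ?case by (simp only: funpow_Suc_right comp_apply)
qed

section \<open>Meeting of the chains and summability of the gaps\<close>

lemma AE_draws: "AE \<omega> in M. (\<forall>i. X i \<omega> \<in> set_pmf Q) \<and> (\<forall>i. r i \<omega> < 1)"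
proof -
  have "AE \<omega> in M. X i \<omega> \<in> set_pmf Q" for i
  proof (rule AE_distrD[OF measurable_X])
    show "AE x in distr M (count_space UNIV) (X i). x \<in> set_pmf Q"
      unfolding distr_X[of i] by (rule AE_measure_pmf)
  qed
  moreover have "AE \<omega> in M. r i \<omega> < 1" for i
  proof (rule AE_distrD[OF measurable_r])
    have "AE u in lborel. u \<in> {0..1} \<longrightarrow> u < (1::real)"
      using AE_lborel_singleton[of 1] by eventually_elim auto
    then show "AE u in distr M borel (r i). u < 1"
      unfolding distr_r by (intro AE_uniform_measureI) auto
  qed
  ultimately show ?thesis
    by (simp add: AE_all_countable)
qed

text \<open>The proposals counted are those of passes 2 to \<open>n + 1\<close>, in which both
  chains move.\<close>

lemma prob_never_proposed:
  "prob {\<omega> \<in> space M. \<forall>j\<in>{1..n}. X (Suc j) \<omega> \<noteq> z} = (1 - pmf Q z) ^ n"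
\<comment> \<open>The product rule \<open>indep_setsD\<close> asks for a nonempty index set.\<close>
proof (cases "n = 0")
  case False
  let ?A = "\<lambda>d. case d of Proposal j \<Rightarrow> X j -` (- {z}) \<inter> space M | _ \<Rightarrow> space M"
  let ?J = "(\<lambda>j. Proposal (Suc j)) ` {1..n}"
  have "prob (X j -` (- {z}) \<inter> space M) = 1 - pmf Q z" for j
  proof -
    have "prob (X j -` (- {z}) \<inter> space M) = measure_pmf.prob Q (- {z})"
      unfolding distr_X[of j, symmetric] by (simp add: measure_distr)
    then show ?thesis
      using measure_pmf.prob_compl[of "{z}" Q] by (simp add: Compl_eq_Diff_UNIV pmf.rep_eq)
  qed
  moreover have "prob (\<Inter>d\<in>?J. ?A d) = (\<Prod>d\<in>?J. prob (?A d))"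
    using False by (intro indep_setsD[OF indep[unfolded indep_draws_def]]) auto
  moreover have "(\<Inter>d\<in>?J. ?A d) = {\<omega> \<in> space M. \<forall>j\<in>{1..n}. X (Suc j) \<omega> \<noteq> z}"
    using False by auto
  ultimately show ?thesis
    by (simp add: prod.reindex inj_on_def)
qed (simp add: prob_space)

text \<open>A common bound for the inverse weights on the support: a sum of positive terms dominates
  each of them.\<close>

definition cap :: real where
  "cap = (\<Sum>x\<in>set_pmf Q. inverse (w x))"

text \<open>
  Agrees with \<open>inverse\<close> on all weights, including the junk value \<open>0 = inverse 0\<close> outside the support,
  but is bounded on the whole real line.
\<close>

definition capped_inverse :: "real \<Rightarrow> real" where
  "capped_inverse v = min cap \<bar>inverse v\<bar>"

lemma measurable_capped_inverse [measurable]: "capped_inverse \<in> borel_measurable borel"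
  unfolding capped_inverse_def[abs_def] by measurable

lemma cap_nonneg: "0 \<le> cap"
  unfolding cap_def by (intro sum_nonneg) (auto simp: less_imp_le weight_pos)

lemma capped_inverse_bounds: "0 \<le> capped_inverse v" "capped_inverse v \<le> cap"
  using cap_nonneg by (auto simp: capped_inverse_def)

lemma capped_inverse_abs_le: "\<bar>capped_inverse v\<bar> \<le> cap"
  using capped_inverse_bounds[of v] by simp

lemma capped_inverse_eq:
  assumes "v \<in> range w" shows "capped_inverse v = inverse v"
proof -
  obtain x where x: "v = w x" using assms by auto
  show ?thesis
  proof (cases "x \<in> set_pmf Q")
    case True
    then have "inverse (w x) \<le> cap"
      unfolding cap_def using finite_support
      by (intro member_le_sum) (auto simp: less_imp_le weight_pos)
    then show ?thesis
      using weight_pos[OF True] by (simp add: x capped_inverse_def)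
  next
    case False
    then show ?thesis
      using cap_nonneg by (simp add: x capped_inverse_def weight_0)
  qed
qed

text \<open>The increment of pass \<open>Suc i\<close> before division by
  \<open>tail (Suc i)\<close>. Capping makes it bounded everywhere without changing its value, by
  \<open>gap_eq\<close>.\<close>

definition gap :: "nat \<Rightarrow> 'w \<Rightarrow> real" where
  "gap i \<omega> = capped_inverse (leading (Suc i) \<omega>) - capped_inverse (lagging (Suc i) \<omega>)"

lemma measurable_gap [measurable]: "gap i \<in> borel_measurable M"
  unfolding gap_def[abs_def] by measurable

lemma gap_abs_le: "\<bar>gap i \<omega>\<bar> \<le> cap"
  unfolding gap_def
  using capped_inverse_bounds[of "leading (Suc i) \<omega>"] capped_inverse_bounds[of "lagging (Suc i) \<omega>"] by linarith

lemma gap_eq: "gap i \<omega> = inverse (leading (Suc i) \<omega>) - inverse (lagging (Suc i) \<omega>)"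
  unfolding gap_def by (intro arg_cong2[where f = minus] capped_inverse_eq lead_in lag_in) auto

lemma integrable_gap: "integrable M (gap i)"
  by (rule integrable_const_bound[where B = cap]) (auto simp: gap_abs_le)

text \<open>After \<open>Suc i\<close> passes the leading chain has made \<open>Suc i\<close>
  transitions and the lagging one \<open>i\<close>, so the gaps have the consecutive differences of
  one sequence as means.\<close>

lemma expectation_gap:
  "expectation (gap i) =
    (\<Sum>x\<in>set_pmf Q. pmf Q x * (mh_op Q w ^^ Suc i) capped_inverse (w x)) -
    (\<Sum>x\<in>set_pmf Q. pmf Q x * (mh_op Q w ^^ i) capped_inverse (w x))"
proof -
  have "integrable M (\<lambda>\<omega>. capped_inverse (leading n \<omega>))" "integrable M (\<lambda>\<omega>. capped_inverse (lagging n \<omega>))" for n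
    by (rule integrable_const_bound[where B = cap]; auto simp: capped_inverse_abs_le)+
  then show ?thesis
    unfolding gap_def
    by (simp only: Bochner_Integration.integral_diff
        expectation_leading[OF measurable_capped_inverse capped_inverse_abs_le]
        expectation_lagging[OF measurable_capped_inverse capped_inverse_abs_le])
qed

text \<open>The gap is at most \<open>cap\<close>, and it vanishes once the maximal state
  \<open>z\<close> has been proposed in one of the passes 2 to \<open>i + 1\<close>. This leaves a
  geometric bound.\<close>

lemma summable_expectation_gap: "summable (\<lambda>i. expectation (\<lambda>\<omega>. \<bar>gap i \<omega>\<bar>))"
proof -
  obtain z where z: "z \<in> set_pmf Q" "\<And>x. x \<in> set_pmf Q \<Longrightarrow> w x \<le> w z"
    using maximal_weight[OF finite_support, of w] by blast
  have bound: "expectation (\<lambda>\<omega>. \<bar>gap i \<omega>\<bar>) \<le> cap * (1 - pmf Q z) ^ i" for i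
  proof -
    define B where "B = {\<omega> \<in> space M. \<forall>j\<in>{1..i}. X (Suc j) \<omega> \<noteq> z}"
    have [measurable]: "B \<in> events" unfolding B_def by measurable
    have "AE \<omega> in M. \<bar>gap i \<omega>\<bar> \<le> cap * indicator B \<omega>"
      using AE_draws AE_space
    proof eventually_elim
      case (elim \<omega>)
      show ?case
      proof (cases "\<omega> \<in> B")
        case False
        then obtain j where "1 \<le> j" "j \<le> i" "X (Suc j) \<omega> = z"
          using elim by (auto simp: B_def)
        then have "leading (Suc i) \<omega> = lagging (Suc i) \<omega>"
          using elim weight_pos z by (intro chains_coupled[where b = "w z" and j = j]) auto
        then show ?thesis using False by (simp add: gap_def)
      qed (simp add: gap_abs_le)
    qed
    then have "expectation (\<lambda>\<omega>. \<bar>gap i \<omega>\<bar>) \<le> expectation (\<lambda>\<omega>. cap * indicator B \<omega>)"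
      using integrable_gap
      by (intro integral_mono_AE integrable_abs integrable_mult_right integrable_real_indicator)
        (auto simp: less_top[symmetric])
    also have "\<dots> = cap * (1 - pmf Q z) ^ i"
      using prob_never_proposed[of i z] by (simp add: B_def)
    finally show ?thesis .
  qed
  have "summable (\<lambda>i. cap * (1 - pmf Q z) ^ i)"
    using pmf_positive[OF z(1)] pmf_le_1[of Q z] by (intro summable_mult summable_geometric) auto
  then show ?thesis
  proof (rule summable_comparison_test')
    fix i
    have "0 \<le> expectation (\<lambda>\<omega>. \<bar>gap i \<omega>\<bar>)"
      by (rule Bochner_Integration.integral_nonneg) simp
    then show "norm (expectation (\<lambda>\<omega>. \<bar>gap i \<omega>\<bar>)) \<le> cap * (1 - pmf Q z) ^ i"
      using bound[of i] by (simp only: real_norm_def abs_of_nonneg)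
  qed
qed

section \<open>Removing the stopping time and telescoping\<close>

lemma indep_gap_stop: "indep_var borel (gap i) borel (\<lambda>\<omega>. real (N \<omega>))"
proof -
  have "past (Suc i) \<inter> {Stop} = {}" by (auto simp: past_def)
  moreover have "(\<lambda>y. capped_inverse (lead (\<lambda>i. y (Proposal i)) (\<lambda>i. y (Uniform i)) (Suc i)) -
      capped_inverse (lag (\<lambda>i. y (Proposal i)) (\<lambda>i. y (Uniform i)) (Suc i)))
      \<in> borel_measurable (PiM (past (Suc i)) (\<lambda>_. borel))"
    by (intro borel_measurable_diff measurable_compose[OF _ measurable_capped_inverse] measurable_lead_past measurable_lag_past)
  moreover have "(\<lambda>y. y Stop) \<in> borel_measurable (PiM {Stop} (\<lambda>_. borel :: real measure))"
    by (rule measurable_component_singleton) simp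
  ultimately have "distr M borel (gap i) \<Otimes>\<^sub>M distr M borel (\<lambda>\<omega>. real (N \<omega>)) =
      distr M (borel \<Otimes>\<^sub>M borel) (\<lambda>\<omega>. (gap i \<omega>, real (N \<omega>)))"
    by (rule joint_distr_draws) (simp_all only: gap_def leading_past[symmetric] lagging_past[symmetric], simp)
  then show ?thesis
    by (simp add: indep_var_distribution_eq)
qed

text \<open>The extra factor has mean 1 and is independent of the gap. It is applied with
  \<open>h\<close> the identity for the mean and with \<open>h = abs\<close> for
  summability.\<close>

lemma expectation_gap_stopped:
  assumes [measurable]: "h \<in> borel_measurable borel" and "integrable M (\<lambda>\<omega>. h (gap i \<omega>))"
    and tail: "0 < prob {\<omega> \<in> space M. n \<le> N \<omega>}"
  shows "expectation (\<lambda>\<omega>. h (gap i \<omega>) * (of_bool (n \<le> N \<omega>) / prob {\<omega> \<in> space M. n \<le> N \<omega>})) =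
    expectation (\<lambda>\<omega>. h (gap i \<omega>))"
proof -
  let ?t = "prob {\<omega> \<in> space M. n \<le> N \<omega>}"
  define k :: "real \<Rightarrow> real" where "k v = of_bool (real n \<le> v) / ?t" for v
  have [measurable]: "k \<in> borel_measurable borel" unfolding k_def by measurable
  have k: "k (real (N \<omega>)) = indicator {\<omega> \<in> space M. n \<le> N \<omega>} \<omega> / ?t" if "\<omega> \<in> space M" for \<omega>
    using that by (simp add: k_def indicator_def)
  have int: "integrable M (\<lambda>\<omega>. k (real (N \<omega>)))"
    by (rule integrable_const_bound[where B = "1 / ?t"]) (auto simp: k_def)
  have "expectation (\<lambda>\<omega>. k (real (N \<omega>))) = 1"
    using tail by (simp add: k cong: Bochner_Integration.integral_cong)
  moreover have "indep_var borel (\<lambda>\<omega>. h (gap i \<omega>)) borel (\<lambda>\<omega>. k (real (N \<omega>)))"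
    using indep_var_compose[OF indep_gap_stop, of h borel k borel] by (simp add: comp_def)
  ultimately have "expectation (\<lambda>\<omega>. h (gap i \<omega>) * k (real (N \<omega>))) = expectation (\<lambda>\<omega>. h (gap i \<omega>))"
    using indep_var_lebesgue_integral[OF _ assms(2) int] by simp
  then show ?thesis by (simp add: k_def)
qed

lemma fce_unbiased:
  fixes tail :: "nat \<Rightarrow> real"
  assumes tail: "\<And>i. tail i = prob {\<omega> \<in> space M. i \<le> N \<omega>}" and tail_pos: "\<And>i. 0 < tail i"
    and S: "\<And>\<omega>. S \<omega> = fce_output tail (\<lambda>i. w (X i \<omega>)) (\<lambda>i. r i \<omega>) (N \<omega>)"
  shows "integrable M S" "expectation S = 1 / (\<Sum>x\<in>set_pmf Q. pmf Q x * w x)"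
proof -
  define f where "f i \<omega> = gap i \<omega> * (of_bool (Suc i \<le> N \<omega>) / tail (Suc i))" for i \<omega>
  define m where "m n = (\<Sum>x\<in>set_pmf Q. pmf Q x * (mh_op Q w ^^ n) capped_inverse (w x))" for n
  \<comment> \<open>The random upper limit of the sum moves into the factor
    \<open>of_bool (Suc i \<le> N \<omega>)\<close>; at each sample point only finitely many terms
    of the series are nonzero.\<close>
  have S_eq: "S = (\<lambda>\<omega>. capped_inverse (w (X 0 \<omega>)) + (\<Sum>i. f i \<omega>))"
  proof
    fix \<omega>
    have "(\<Sum>i. f i \<omega>) = (\<Sum>i<N \<omega>. f i \<omega>)"
      by (rule suminf_finite) (auto simp: f_def)
    then show "S \<omega> = capped_inverse (w (X 0 \<omega>)) + (\<Sum>i. f i \<omega>)"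
      by (simp add: S fce_output_def fce_state_eq f_def gap_eq capped_inverse_eq)
  qed
  have [measurable]: "f i \<in> borel_measurable M" for i
    unfolding f_def[abs_def] by measurable
  have f_int: "integrable M (f i)" for i
    by (rule integrable_const_bound[where B = "cap / tail (Suc i)"])
      (auto simp: f_def abs_mult gap_abs_le cap_nonneg tail_pos less_imp_le divide_right_mono)
  have "expectation (\<lambda>\<omega>. norm (f i \<omega>)) = expectation (\<lambda>\<omega>. \<bar>gap i \<omega>\<bar>)" for i
    using expectation_gap_stopped[of abs i "Suc i"] integrable_gap[of i] tail_pos[of "Suc i"]
    by (simp add: f_def abs_mult tail)
  then have f_sums: "summable (\<lambda>i. expectation (\<lambda>\<omega>. norm (f i \<omega>)))"
    using summable_expectation_gap by simp
  have f_exp: "expectation (f i) = m (Suc i) - m i" for i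
    using expectation_gap_stopped[of "\<lambda>x. x" i "Suc i"] integrable_gap[of i] tail_pos[of "Suc i"]
    by (simp add: f_def[abs_def] tail expectation_gap m_def)
  have f_AE: "AE \<omega> in M. summable (\<lambda>i. norm (f i \<omega>))"
  proof (rule AE_I2)
    fix \<omega>
    show "summable (\<lambda>i. norm (f i \<omega>))"
      by (rule summable_finite[of "{..<N \<omega>}"]) (auto simp: f_def)
  qed
  have "m \<longlonglongrightarrow> (\<Sum>x\<in>set_pmf Q. pmf Q x * w x * capped_inverse (w x)) / (\<Sum>x\<in>set_pmf Q. pmf Q x * w x)"
    unfolding m_def[abs_def] using weight_pos finite_support by (rule mh_op_iterate_tendsto)
  \<comment> \<open>On the support the weight cancels its inverse, so the numerator of the limit is
    the total mass 1.\<close>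
  moreover have "(\<Sum>x\<in>set_pmf Q. pmf Q x * w x * capped_inverse (w x)) = (\<Sum>x\<in>set_pmf Q. pmf Q x)"
    by (intro sum.cong refl) (use weight_pos in \<open>force simp: capped_inverse_eq\<close>)
  ultimately have m: "m \<longlonglongrightarrow> 1 / (\<Sum>x\<in>set_pmf Q. pmf Q x * w x)"
    by (simp add: sum_pmf_set_pmf finite_support)
  have "(\<lambda>i. expectation (f i)) sums (1 / (\<Sum>x\<in>set_pmf Q. pmf Q x * w x) - m 0)"
    unfolding f_exp by (rule telescope_sums[OF m])
  then have tail_sum: "expectation (\<lambda>\<omega>. \<Sum>i. f i \<omega>) = 1 / (\<Sum>x\<in>set_pmf Q. pmf Q x * w x) - m 0"
    using sums_integral[OF f_int f_AE f_sums] sums_unique2 by blast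
  have int0: "integrable M (\<lambda>\<omega>. capped_inverse (w (X 0 \<omega>)))"
    by (rule integrable_const_bound[where B = cap]) (auto simp: capped_inverse_abs_le)
  have int: "integrable M (\<lambda>\<omega>. \<Sum>i. f i \<omega>)"
    by (rule integrable_suminf[OF f_int f_AE f_sums])
  show "integrable M S"
    unfolding S_eq by (intro Bochner_Integration.integrable_add int0 int)
  \<comment> \<open>The \<open>- m 0\<close> left by telescoping cancels the expectation of the
    initial term.\<close>
  show "expectation S = 1 / (\<Sum>x\<in>set_pmf Q. pmf Q x * w x)"
    unfolding S_eq using tail_sum expectation_proposal[of "\<lambda>x. capped_inverse (w x)" 0]
    by (simp add: Bochner_Integration.integral_add[OF int0 int] m_def)
qed

end

theorem proposition3:
  fixes \<X> :: "'a set" and P Q :: "'a pmf" and Pstar :: "'a \<Rightarrow> real" and Z :: real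
    and M :: "'w measure" and N :: "'w \<Rightarrow> nat"
    and X :: "nat \<Rightarrow> 'w \<Rightarrow> 'a" and r :: "nat \<Rightarrow> 'w \<Rightarrow> real"
    and tail :: "nat \<Rightarrow> real" and S :: "'w \<Rightarrow> real"
  assumes "finite \<X>"
    and "set_pmf Q \<subseteq> \<X>" and "\<And>x. x \<in> \<X> \<Longrightarrow> pmf Q x > 0"
    and "\<And>x. x \<in> \<X> \<Longrightarrow> Pstar x > 0"
    and "Z = (\<Sum>x\<in>\<X>. Pstar x)"
    and "set_pmf P \<subseteq> \<X>" and "\<And>x. x \<in> \<X> \<Longrightarrow> pmf P x = Pstar x / Z"
    and "prob_space M"
    and "N \<in> measurable M (count_space UNIV)"
    and "\<And>i. X i \<in> measurable M (count_space UNIV)"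
    and "\<And>i. r i \<in> borel_measurable M"
    and "indep_draws M N X r"
    and "\<And>i. distr M (count_space UNIV) (X i) = measure_pmf Q"
    and "\<And>i. distr M borel (r i) = uniform_measure lborel {0..1}"
    and "\<And>i. tail i = measure M {\<omega> \<in> space M. N \<omega> \<ge> i}"
    and "\<And>i. tail i > 0"
    and "\<And>\<omega>. S \<omega> = fce_output tail (\<lambda>i. weight Pstar Q (X i \<omega>)) (\<lambda>i. r i \<omega>) (N \<omega>)"
  shows "integrable M S \<and> integral\<^sup>L M S = 1 / Z"
proof -
  interpret prob_space M by fact
  have supp: "set_pmf Q = \<X>"
    using assms(2,3) pmf_positive_iff by fast
  have zero: "weight Pstar Q x = 0" if "x \<notin> set_pmf Q" for x
    using that by (simp add: weight_def set_pmf_iff)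
  interpret coupled_chains M Q "weight Pstar Q" N X r
  proof
    show "finite (set_pmf Q)"
      using supp assms(1) by simp
    show "0 < weight Pstar Q x" if "x \<in> set_pmf Q" for x
      using that supp assms(3,4) by (simp add: weight_def)
  qed (fact zero assms)+
  \<comment> \<open>Multiplying by \<open>pmf Q x\<close> undoes the division in the weight, so the
    normalising sum is that of \<open>Pstar\<close>.\<close>
  have "(\<Sum>x\<in>set_pmf Q. pmf Q x * weight Pstar Q x) = Z"
    unfolding supp assms(5) by (intro sum.cong refl) (use assms(3) in \<open>force simp: weight_def\<close>)
  then show ?thesis
    using fce_unbiased[OF assms(15,16,17)] by simp
qed

end
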